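(* Let $n\ge 1$ be an integer and let $p$ be a prime number with $p\le n$. Then there exists a number field $\mathbb{K}$ of degree $n$ over $\mathbb{Q}$ such that $p\mid i(\mathbb{K})$.
   Context: For a number field $\mathbb{K}$ of degree $n$ over $\mathbb{Q}$ with ring of integers $\mathbb{A}$, let $\widehat{\mathbb{A}}$ be the set of $\theta\in\mathbb{A}$ that are primitive over $\mathbb{Q}$, i.e. $\mathbb{K}=\mathbb{Q}(\theta)$. For $\theta\in\mathbb{A}$ let $F_\theta(x)\in\mathbb{Z}[x]$ be the (degree $n$) characteristic polynomial of $\theta$ over $\mathbb{Q}$ and set $i(\theta)=\gcd_{x\in\mathbb{Z}}F_\theta(x)$. Define $i(\mathbb{K})=\operatorname{lcm}_{\theta\in\widehat{\mathbb{A}}}\, i(\theta)$. *)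

theory Defs
  imports
    "HOL-Algebra.Algebraic_Closure_Type"
    "HOL-Algebra.Generated_Fields"
    "HOL-Algebra.Embedded_Algebras"
    "Jordan_Normal_Form.Char_Poly"
begin

text \<open>
  Number fields are taken inside \<open>complex\<close>; up to isomorphism this is no restriction, since
  every number field embeds into the complex numbers. HOL-Algebra's notions of subfield,
  dimension, basis and generated field are used in the ring of all complex numbers, with
  scalars \<open>\<rat> :: complex set\<close>.
\<close>

abbreviation complex_field :: "complex ring" where
  "complex_field \<equiv> ring_of_type_algebra"

definition number_field :: "complex set \<Rightarrow> bool" where
  "number_field K \<longleftrightarrow> subfield K complex_field \<and> ring.finite_dimension complex_field \<rat> K"

definition field_degree :: "complex set \<Rightarrow> nat" where
  "field_degree K = ring.dim complex_field \<rat> K"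

definition ring_of_integers :: "complex set \<Rightarrow> complex set" where
  "ring_of_integers K = {\<theta> \<in> K. algebraic_int \<theta>}"

text \<open>The subfield generated by \<open>\<theta>\<close> already contains \<open>\<rat>\<close>, so it is \<open>\<rat>(\<theta>)\<close>.\<close>

definition primitive_integers :: "complex set \<Rightarrow> complex set" where
  "primitive_integers K = {\<theta> \<in> ring_of_integers K. generate_field complex_field {\<theta>} = K}"

definition rational_basis :: "complex set \<Rightarrow> complex list \<Rightarrow> bool" where
  "rational_basis K bs \<longleftrightarrow>
     ring.independent complex_field \<rat> bs \<and> ring.Span complex_field \<rat> bs = K"

text \<open>Column \<open>j\<close> of \<open>A\<close> holds the coordinates of \<open>\<theta> * bs ! j\<close>.\<close>

definition is_mult_matrix :: "complex list \<Rightarrow> complex \<Rightarrow> rat mat \<Rightarrow> bool" where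
  "is_mult_matrix bs \<theta> A \<longleftrightarrow>
     A \<in> carrier_mat (length bs) (length bs) \<and>
     (\<forall>j<length bs. \<theta> * bs ! j = (\<Sum>i<length bs. of_rat (A $$ (i, j)) * bs ! i))"

text \<open>
  The characteristic polynomial of multiplication by \<open>\<theta>\<close> on the \<open>\<rat>\<close>-vector space \<open>K\<close>, as an
  integer polynomial. It does not depend on the basis, and it has integer coefficients if
  \<open>\<theta>\<close> is an algebraic integer of \<open>K\<close>; the description is only meaningful for such \<open>\<theta>\<close>.
\<close>

definition int_char_poly :: "complex set \<Rightarrow> complex \<Rightarrow> int poly" where
  "int_char_poly K \<theta> =
     (THE F. \<exists>bs A. rational_basis K bs \<and> is_mult_matrix bs \<theta> A \<and>
        map_poly rat_of_int F = char_poly A)"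

definition element_index :: "complex set \<Rightarrow> complex \<Rightarrow> int" where
  "element_index K \<theta> = (GCD x \<in> UNIV. poly (int_char_poly K \<theta>) x)"

text \<open>
  \<open>Lcm\<close> of an infinite set of integers is \<open>0\<close>. This does not occur below: the values of a monic
  integer polynomial of degree \<open>n\<close> have a gcd dividing \<open>fact n\<close>, so the indices \<open>element_index K \<theta>\<close>
  with \<open>\<theta>\<close> an algebraic integer of \<open>K\<close> form a finite set of positive integers.
\<close>

definition field_index :: "complex set \<Rightarrow> int" where
  "field_index K = (LCM \<theta> \<in> primitive_integers K. element_index K \<theta>)"

end

theory Submission
  imports
    Defs
    "HOL-Number_Theory.Residues"
begin

text \<open>
  Let \<open>q\<close> be a prime divisor of \<open>2 * p - 1\<close> and
  \<open>F = x ^ n + (2 * p - 1) * x ^ (n - p + 1) + p * q\<close>. Eisenstein's criterion at \<open>q\<close> shows that \<open>F\<close>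
  is irreducible. Modulo \<open>p\<close> it is \<open>x ^ (n - p) * (x ^ p - x)\<close>, so all its values are divisible by
  \<open>p\<close> by Fermat's little theorem. A root of \<open>F\<close> generates a field of degree \<open>n\<close> in which
  its characteristic polynomial is \<open>F\<close>: the characteristic polynomial is monic of degree \<open>n\<close>
  and vanishes at the root, while no nonzero rational polynomial of smaller degree does.
\<close>

section \<open>Eisenstein's criterion\<close>

text \<open>Which of two factors has a constant term prime to \<open>q\<close> is not known in
  advance, so this half of the argument fixes one order of the factors and is later applied to
  both.\<close>

lemma eisenstein_aux:
  fixes G H :: "'a :: idom poly"
  assumes q: "prime_elem q"
    and coeffs: "\<And>i. i < degree (G * H) \<Longrightarrow> q dvd coeff (G * H) i"
    and G0: "\<not> q dvd coeff G 0"
    and H: "\<not> q dvd coeff H (degree H)"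
    and deg: "degree H < degree (G * H)"
  shows False
proof -
  \<comment> \<open>For the least such \<open>k\<close>, all terms of the \<open>k\<close>-th coefficient of \<open>G * H\<close> but one are divisible by \<open>q\<close>.\<close>
  define k where "k = (LEAST k. \<not> q dvd coeff H k)"
  have k: "\<not> q dvd coeff H k"
    unfolding k_def using H by (rule LeastI)
  have less: "q dvd coeff H j" if "j < k" for j
    using not_less_Least[of j "\<lambda>k. \<not> q dvd coeff H k"] that unfolding k_def by blast
  have "k \<le> degree H"
    unfolding k_def using H by (rule Least_le)
  hence "q dvd coeff (G * H) k"
    using deg coeffs by simp
  also have "coeff (G * H) k =
      coeff G 0 * coeff H k + (\<Sum>i\<in>{1..k}. coeff G i * coeff H (k - i))"
    by (simp add: coeff_mult atMost_atLeast0 sum.atLeast_Suc_atMost)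
  finally have *: "q dvd coeff G 0 * coeff H k + (\<Sum>i\<in>{1..k}. coeff G i * coeff H (k - i))" .
  have "q dvd (\<Sum>i\<in>{1..k}. coeff G i * coeff H (k - i))"
    by (intro dvd_sum dvd_mult less) auto
  with * have "q dvd coeff G 0 * coeff H k"
    by (simp add: dvd_add_left_iff)
  thus False
    using q G0 k prime_elem_dvd_mult_iff by blast
qed

text \<open>Since \<open>F\<close> is monic, the leading coefficients of its factors are units.
  Hence a constant factor is a unit, and \<open>q\<close> divides neither leading coefficient, as
  \<open>eisenstein_aux\<close> requires.\<close>

lemma eisenstein:
  fixes F :: "'a :: idom poly"
  assumes q: "prime_elem q"
    and monic: "lead_coeff F = 1"
    and deg: "degree F > 0"
    and coeffs: "\<And>i. i < degree F \<Longrightarrow> q dvd coeff F i"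
    and const: "\<not> q ^ 2 dvd coeff F 0"
  shows "irreducible F"
proof (rule irreducibleI)
  show "F \<noteq> 0" using deg by auto
  show "\<not> F dvd 1" using deg by (auto simp: poly_dvd_1)
next
  fix G H assume F: "F = G * H"
  have nz: "G \<noteq> 0" "H \<noteq> 0" using F deg by auto
  have lc: "lead_coeff G * lead_coeff H = 1"
    using monic by (simp add: F lead_coeff_mult)
  hence units: "lead_coeff G dvd 1" "lead_coeff H dvd 1"
    by (metis dvd_triv_left, metis dvd_triv_right)
  have not_dvd: "\<not> q dvd u" if "u dvd 1" for u
    using q that by (meson dvd_trans prime_elem_not_unit)
  show "G dvd 1 \<or> H dvd 1"
  proof (rule ccontr)
    assume "\<not> (G dvd 1 \<or> H dvd 1)"
    hence "degree G > 0" "degree H > 0"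
      using units unfolding poly_dvd_1 by (metis gr0I)+
    hence degs: "degree G < degree F" "degree H < degree F"
      using nz by (auto simp: F degree_mult_eq)
    have "coeff F 0 = coeff G 0 * coeff H 0"
      by (simp add: F coeff_mult_0)
    hence "\<not> q dvd coeff G 0 \<or> \<not> q dvd coeff H 0"
      using const by (auto simp: power2_eq_square intro: mult_dvd_mono)
    thus False
      using eisenstein_aux[OF q, of G H] eisenstein_aux[OF q, of H G] coeffs degs
        not_dvd[OF units(1)] not_dvd[OF units(2)]
      by (auto simp: F mult.commute)
  qed
qed

section \<open>Degrees of polynomials vanishing at a root of an irreducible polynomial\<close>

text \<open>Descent by pseudo-division: unless it is zero, the remainder of \<open>F\<close> by
  \<open>h\<close> has smaller degree than \<open>h\<close> and again vanishes at \<open>x\<close>.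
  If it is zero, \<open>F\<close> divides \<open>h * q\<close> and is prime, because integer
  polynomials form a factorial ring.\<close>

lemma irreducible_root_degree_le:
  fixes F h :: "int poly" and x :: "'a :: field_char_0"
  assumes irr: "irreducible F"
    and F: "poly (map_poly of_int F) x = 0"
    and h: "h \<noteq> 0" "poly (map_poly of_int h) x = 0"
  shows "degree F \<le> degree h"
  using h
proof (induction "degree h" arbitrary: h rule: less_induct)
  case less
  define r where "r = pseudo_mod F h"
  from pseudo_mod[OF less.prems(1), of F] obtain a q
    where a: "a \<noteq> 0" and eq: "smult a F = h * q + r"
    by (auto simp: r_def)
  have r: "r = 0 \<or> degree r < degree h"
    using pseudo_mod[OF less.prems(1), of F] by (auto simp: r_def)
  have "poly (map_poly of_int (smult a F)) x = 0"
    using F by (simp add: of_int_hom.map_poly_hom_smult)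
  hence root: "poly (map_poly of_int r) x = 0"
    using less.prems(2) unfolding eq by (simp add: of_int_poly_hom.hom_add of_int_poly_hom.hom_mult)
  show ?case
  proof (cases "r = 0")
    case False
    with less.hyps[of r] r root show ?thesis by fastforce
  next
    case True
    have "prime_elem F" using irr irreducible_imp_prime_elem by blast
    moreover have "F dvd h * q" using eq True by (metis add.right_neutral dvd_smult dvd_refl)
    ultimately consider "F dvd h" | "F dvd q" using prime_elem_dvd_mult_iff by blast
    thus ?thesis
    proof cases
      case 1
      thus ?thesis using less.prems(1) by (rule dvd_imp_degree_le)
    next
      case 2
      then obtain k where k: "q = F * k" by auto
      \<comment> \<open>Cancelling \<open>F\<close> shows that \<open>h\<close> divides a nonzero
        constant, so \<open>h\<close> is itself a nonzero constant and cannot vanish at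
        \<open>x\<close>.\<close>
      have "[:a:] * F = (h * k) * F" using eq True by (simp add: k mult_ac)
      moreover have "F \<noteq> 0" using irr by (auto simp: irreducible_def)
      ultimately have hk: "[:a:] = h * k" using mult_right_cancel by blast
      hence "h * k \<noteq> 0" using a by (metis pCons_eq_0_iff)
      hence "degree h = 0"
        using hk degree_mult_eq[of h k] by (metis add_is_0 degree_pCons_0 mult_eq_0_iff)
      then obtain c where "h = [:c:]" by (rule degree_eq_zeroE)
      thus ?thesis using less.prems by simp
    qed
  qed
qed

lemma rat_poly_clear_denominators:
  fixes g :: "rat poly"
  obtains c :: int and h :: "int poly" where "c \<noteq> 0" "smult (of_int c) g = map_poly of_int h"
proof -
  have "\<exists>c h. c \<noteq> 0 \<and> smult (of_int c) g = map_poly of_int h"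
  proof (induction g)
    case 0
    show ?case by (intro exI[of _ 1] exI[of _ 0]) simp
  next
    case (pCons a g)
    then obtain c h where c: "c \<noteq> 0" "smult (of_int c) g = map_poly of_int h" by blast
    obtain u v where uv: "a = of_int u / of_int v" "v \<noteq> 0"
      by (metis Fract_of_int_quotient Rat_cases less_numeral_extra(3))
    have "smult (of_int (v * c)) (pCons a g) = map_poly of_int (pCons (u * c) (smult v h))"
      using c uv by (simp add: of_int_hom.map_poly_pCons_hom of_int_hom.map_poly_hom_smult flip: c(2))
    thus ?case using c(1) uv(2) by (metis mult_eq_0_iff)
  qed
  thus ?thesis using that by blast
qed

text \<open>Clearing denominators changes neither the degree nor the roots. Thus \<open>F\<close>
  has the degree of the minimal polynomial of \<open>x\<close>, which drives the later comparisons
  with characteristic polynomials.\<close>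

lemma irreducible_root_degree_le_rat:
  fixes F :: "int poly" and g :: "rat poly" and x :: "'a :: field_char_0"
  assumes irr: "irreducible F"
    and F: "poly (map_poly of_int F) x = 0"
    and g: "g \<noteq> 0" "poly (map_poly of_rat g) x = 0"
  shows "degree F \<le> degree g"
proof -
  obtain c :: int and h where c: "c \<noteq> 0" and h: "smult (of_int c) g = map_poly of_int h"
    by (rule rat_poly_clear_denominators)
  have "map_poly of_int h = (map_poly of_rat (map_poly of_int h) :: 'a poly)"
    by (simp add: map_poly_map_poly o_def)
  also have "\<dots> = smult (of_int c) (map_poly of_rat g)"
    by (simp add: of_rat_hom.map_poly_hom_smult flip: h)
  finally have "poly (map_poly of_int h) x = 0"
    using g(2) by simp
  moreover have "h \<noteq> 0" using c g(1) h by auto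
  ultimately have "degree F \<le> degree h"
    using irreducible_root_degree_le[OF irr F] by blast
  also have "degree h = degree (map_poly of_int h :: rat poly)" by simp
  also have "\<dots> = degree g" using c by (simp flip: h)
  finally show ?thesis .
qed

section \<open>The complex numbers as a field of HOL-Algebra, with the rationals as scalars\<close>

lemma field_complex_field: "field complex_field"
  by (rule field_from_type_algebra)

interpretation complex_field: domain complex_field
  using field_complex_field by (rule field.axioms(1))

lemma complex_field_simps [simp]:
  "carrier complex_field = UNIV" "x \<otimes>\<^bsub>complex_field\<^esub> y = x * y" "x \<oplus>\<^bsub>complex_field\<^esub> y = x + y"
  "\<one>\<^bsub>complex_field\<^esub> = 1" "\<zero>\<^bsub>complex_field\<^esub> = 0"
  by (simp_all add: ring_of_type_algebra_def)

lemma complex_field_a_inv [simp]: "\<ominus>\<^bsub>complex_field\<^esub> x = - x"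
  using complex_field.minus_equality[of "- x" x] by simp

lemma complex_field_m_inv: "x \<noteq> 0 \<Longrightarrow> inv\<^bsub>complex_field\<^esub> x = inverse x"
  using complex_field.comm_inv_char[of x "inverse x"] by simp

lemma complex_field_pow [simp]: "x [^]\<^bsub>complex_field\<^esub> (k :: nat) = x ^ k"
  by (induction k) simp_all

lemma complex_field_combine:
  "length Ks = length Us \<Longrightarrow> complex_field.combine Ks Us = (\<Sum>i<length Us. Ks ! i * Us ! i)"
  by (induction Ks Us rule: list_induct2) (simp_all add: sum.lessThan_Suc_shift del: sum.lessThan_Suc)

text \<open>HOL-Algebra's coefficient lists start with the leading coefficient.\<close>

lemma complex_field_eval: "complex_field.eval (rev xs) x = poly (Poly xs) x"
proof (induction xs)
  case (Cons a xs)
  thus ?case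
    using complex_field.eval_append[of "rev xs" "[a]" x] by (simp add: algebra_simps)
qed simp

lemma subfield_Rats: "subfield \<rat> complex_field"
  by (intro field.subfieldI'[OF field_complex_field] complex_field.subringI) (auto simp: complex_field_m_inv)

lemma Rats_subset_subfield:
  assumes "subfield K complex_field"
  shows "\<rat> \<subseteq> K"
proof
  note sr = subfieldE(1)[OF assms]
  have zero: "0 \<in> K" and one: "1 \<in> K" and minus: "\<And>x. x \<in> K \<Longrightarrow> - x \<in> K"
    and add: "\<And>x y. x \<in> K \<Longrightarrow> y \<in> K \<Longrightarrow> x + y \<in> K"
    and mult: "\<And>x y. x \<in> K \<Longrightarrow> y \<in> K \<Longrightarrow> x * y \<in> K"
    using subringE(2,3,5-7)[OF sr] by auto
  have inverse: "inverse x \<in> K" if "x \<in> K" for x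
    using complex_field.subfield_m_inv(1)[OF assms, of x] that zero complex_field_m_inv[of x]
    by (cases "x = 0") auto
  have nat: "of_nat k \<in> K" for k
    by (induction k) (auto intro: zero one add)
  have int: "of_int k \<in> K" for k
    by (cases k rule: int_cases) (auto simp del: of_nat_Suc intro: nat minus)
  fix x :: complex assume "x \<in> \<rat>"
  then obtain a b where "x = of_int a / of_int b" by (auto elim: Rats_cases')
  thus "x \<in> K" by (auto simp: field_class.field_divide_inverse intro!: mult inverse int)
qed

section \<open>Upper bound for the degree of a generated field\<close>

text \<open>For algebraic \<open>\<theta>\<close> the polynomial expressions in
  \<open>\<theta>\<close> already form a field, and the minimality of each side gives the two
  inclusions. This makes the dimension theorem for simple extensions applicable.\<close>

lemma generate_field_eq_simple_extension:
  assumes "(complex_field.algebraic over \<rat>) \<theta>"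
  shows "generate_field complex_field {\<theta>} = complex_field.simple_extension \<rat> \<theta>"
proof (rule subset_antisym)
  have "subfield (complex_field.simple_extension \<rat> \<theta>) complex_field"
    using assms subfield_Rats by (simp add: complex_field.simple_extension_is_subfield)
  thus "generate_field complex_field {\<theta>} \<subseteq> complex_field.simple_extension \<rat> \<theta>"
    using complex_field.simple_extension_mem[OF subfieldE(1)[OF subfield_Rats], of \<theta>]
    by (intro field.generate_field_min_subfield1[OF field_complex_field]) auto
next
  have "subfield (generate_field complex_field {\<theta>}) complex_field"
    by (rule field.generate_field_is_subfield[OF field_complex_field]) simp
  thus "complex_field.simple_extension \<rat> \<theta> \<subseteq> generate_field complex_field {\<theta>}"
    by (intro complex_field.simple_extension_subring_incl)
      (auto simp: Rats_subset_subfield subfieldE(1) intro: generate_field.incl)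
qed

text \<open>The minimal polynomial \<open>Irr\<close> divides \<open>F\<close>, and its degree is
  the dimension. The reverse bound for irreducible \<open>F\<close> comes later, from characteristic
  polynomials.\<close>

lemma generate_field_dimension_le:
  fixes F :: "int poly"
  assumes F: "F \<noteq> 0" "poly (map_poly of_int F) \<theta> = 0"
  obtains d where "d \<le> degree F"
    "complex_field.dimension d \<rat> (generate_field complex_field {\<theta>})"
proof -
  define L where "L = rev (coeffs (map_poly complex_of_int F))"
  have nz: "L \<noteq> []" using F(1) by (simp add: L_def)
  have "hd L = of_int (lead_coeff F)"
    using F(1) by (simp add: L_def hd_rev last_map last_coeffs_eq_coeff_degree)
  moreover have "set L \<subseteq> \<rat>"
    by (auto simp: L_def coeffs_def)
  ultimately have L: "L \<in> carrier (univ_poly complex_field \<rat>)"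
    using F(1) by (auto simp: univ_poly_def polynomial_def)
  have eval: "complex_field.eval L \<theta> = \<zero>\<^bsub>complex_field\<^esub>"
    using F(2) by (simp add: L_def complex_field_eval del: of_int_hom.coeffs_map_poly_hom)
  have \<theta>: "\<theta> \<in> carrier complex_field" by simp
  have alg: "(complex_field.algebraic over \<rat>) \<theta>"
    by (rule complex_field.algebraicI[OF L nz eval])
  let ?P = "complex_field.Irr \<rat> \<theta>"
  have "?P pdivides\<^bsub>complex_field\<^esub> L"
    by (rule complex_field.Irr_minimal[OF subfield_Rats \<theta> alg L eval])
  \<comment> \<open>The degree of a coefficient list is its length minus one.\<close>
  hence "length ?P - 1 \<le> length L - 1"
    by (rule complex_field.pdivides_imp_degree_le[OF subfieldE(1)[OF subfield_Rats]
        complex_field.IrrE(1)[OF subfield_Rats \<theta> alg] L nz])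
  also have "length L - 1 = degree F"
    by (simp add: L_def degree_eq_length_coeffs)
  finally show ?thesis
    using complex_field.dimension_simple_extension[OF subfield_Rats \<theta> alg]
    unfolding generate_field_eq_simple_extension[OF alg, symmetric] by (rule that)
qed

section \<open>Multiplication matrices and their characteristic polynomials\<close>

lemma ex_mult_matrix:
  assumes K: "subfield K complex_field" "\<theta> \<in> K" and bs: "rational_basis K bs"
  obtains A where "is_mult_matrix bs \<theta> A"
proof -
  have span: "complex_field.Span \<rat> bs = K" using bs by (simp add: rational_basis_def)
  have "\<exists>Ks. length Ks = length bs \<and> \<theta> * bs ! j = (\<Sum>i<length bs. of_rat (Ks ! i) * bs ! i)"
    if "j < length bs" for j
  proof -
    have "bs ! j \<in> K"
      using complex_field.Span_base_incl[OF subfield_Rats, of bs] that span nth_mem by auto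
    hence "\<theta> * bs ! j \<in> complex_field.Span \<rat> bs"
      using subringE(6)[OF subfieldE(1)[OF K(1)] K(2)] span by simp
    then obtain Ks where Ks: "set Ks \<subseteq> \<rat>" "length Ks = length bs"
        "\<theta> * bs ! j = complex_field.combine Ks bs"
      using complex_field.Span_mem_iff_length_version[OF subfield_Rats, of bs] by auto
    \<comment> \<open>The scalars are complex numbers in \<open>\<rat>\<close>, while the matrix has
      entries of type \<open>rat\<close>; \<open>f\<close> picks preimages.\<close>
    have "\<forall>x\<in>set Ks. \<exists>r. x = of_rat r" using Ks(1) by (auto simp: Rats_def)
    then obtain f where f: "\<And>x. x \<in> set Ks \<Longrightarrow> x = of_rat (f x)" by metis
    show ?thesis
      using Ks f by (intro exI[of _ "map f Ks"]) (simp add: complex_field_combine)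
  qed
  then obtain C where C: "\<And>j. j < length bs \<Longrightarrow>
      \<theta> * bs ! j = (\<Sum>i<length bs. of_rat (C j ! i) * bs ! i)" by metis
  have "is_mult_matrix bs \<theta> (Matrix.mat (length bs) (length bs) (\<lambda>(i, j). C j ! i))"
    unfolding is_mult_matrix_def using C by auto
  thus ?thesis using that by blast
qed

text \<open>A characteristic polynomial vanishes at eigenvalues, and \<open>\<theta>\<close> is one
  for the transposed matrix. The entry \<open>b\<close> ensures that the eigenvector is
  nonzero.\<close>

lemma poly_char_poly_mult_matrix:
  assumes A: "is_mult_matrix bs \<theta> A" and b: "b \<in> set bs" "b \<noteq> 0"
  shows "poly (map_poly of_rat (char_poly A)) \<theta> = 0"
proof -
  define n where "n = length bs"
  \<comment> \<open>The columns of \<open>A\<close> hold the coordinates, so the basis is an eigenvector of the transpose.\<close>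
  define B :: "complex mat" where "B = transpose_mat (map_mat of_rat A)"
  have Ac: "A \<in> carrier_mat n n" using A by (simp add: is_mult_matrix_def n_def)
  hence Bc: "B \<in> carrier_mat n n" by (simp add: B_def)
  have eigen: "B *\<^sub>v vec_of_list bs = \<theta> \<cdot>\<^sub>v vec_of_list bs"
  proof (rule eq_vecI)
    fix j assume "j < dim_vec (\<theta> \<cdot>\<^sub>v vec_of_list bs)"
    hence j: "j < n" by (simp add: n_def)
    have "(B *\<^sub>v vec_of_list bs) $ j = (\<Sum>i<n. of_rat (A $$ (i, j)) * bs ! i)"
    proof -
      have "(B *\<^sub>v vec_of_list bs) $ j = (\<Sum>i\<in>{0..<n}. row B j $ i * vec_of_list bs $ i)"
        using j Bc by (simp add: scalar_prod_def n_def)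
      also have "\<dots> = (\<Sum>i<n. of_rat (A $$ (i, j)) * bs ! i)"
        unfolding atLeast0LessThan
        by (rule sum.cong) (use j Ac in \<open>auto simp: B_def vec_of_list_index\<close>)
      finally show ?thesis .
    qed
    also have "\<dots> = \<theta> * bs ! j" using A j by (simp add: is_mult_matrix_def n_def)
    finally show "(B *\<^sub>v vec_of_list bs) $ j = (\<theta> \<cdot>\<^sub>v vec_of_list bs) $ j"
      using j by (simp add: n_def vec_of_list_index)
  next
    have "dim_row B = n" using Bc by (rule carrier_matD)
    thus "dim_vec (B *\<^sub>v vec_of_list bs) = dim_vec (\<theta> \<cdot>\<^sub>v vec_of_list bs)"
      by (simp add: n_def)
  qed
  have nz: "vec_of_list bs \<noteq> 0\<^sub>v n"
  proof
    assume *: "vec_of_list bs = 0\<^sub>v n"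
    obtain i where i: "i < n" "bs ! i = b"
      using b(1) unfolding in_set_conv_nth n_def by blast
    have "b = vec_index (vec_of_list bs) i" unfolding vec_of_list_index i(2) ..
    also have "\<dots> = 0" unfolding * using i(1) by (rule index_zero_vec)
    finally show False using b(2) by (rule notE[rotated])
  qed
  have "vec_of_list bs \<in> carrier_vec n" by (intro carrier_vecI) (simp add: n_def)
  moreover have "dim_row B = n" using Bc by (rule carrier_matD)
  ultimately have "eigenvector B (vec_of_list bs) \<theta>"
    using eigen nz by (simp only: eigenvector_def simp_thms)
  hence "eigenvalue B \<theta>" unfolding eigenvalue_def by (rule exI)
  hence "poly (char_poly B) \<theta> = 0" by (rule eigenvalue_root_char_poly[OF Bc, THEN iffD1])
  also have "char_poly B = map_poly of_rat (char_poly A)"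
    unfolding B_def char_poly_transpose_mat[OF map_carrier_mat[THEN iffD2, OF Ac]]
    by (rule of_rat_hom.char_poly_hom[OF Ac])
  finally show ?thesis .
qed

section \<open>The field generated by a root of a monic irreducible polynomial\<close>

locale irreducible_monic_root =
  fixes F :: "int poly" and \<theta> :: complex
  assumes irr: "irreducible F" and monic: "lead_coeff F = 1"
    and root: "poly (map_poly of_int F) \<theta> = 0"
begin

definition K :: "complex set" where "K = generate_field complex_field {\<theta>}"

lemma subfield_K: "subfield K complex_field"
  unfolding K_def by (rule field.generate_field_is_subfield[OF field_complex_field]) simp

lemma theta_in_K: "\<theta> \<in> K"
  unfolding K_def by (simp add: generate_field.incl)

text \<open>The characteristic polynomial is monic of degree \<open>length bs\<close> and vanishes
  at \<open>\<theta>\<close>, which bounds \<open>length bs\<close> from below. The upper bound is a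
  hypothesis since this lemma is itself used to compute the dimension.\<close>

lemma rational_basis_char_poly:
  assumes bs: "rational_basis K bs" and A: "is_mult_matrix bs \<theta> A"
    and len: "length bs \<le> degree F"
  shows "length bs = degree F" "char_poly A = map_poly of_int F"
proof -
  have Ac: "A \<in> carrier_mat (length bs) (length bs)" using A by (simp add: is_mult_matrix_def)
  \<comment> \<open>The eigenvector argument wants a nonzero entry; zeros alone could not span
    \<open>1\<close>.\<close>
  have "\<exists>b\<in>set bs. b \<noteq> 0"
  proof (rule ccontr)
    assume "\<not> ?thesis"
    hence "(\<Sum>i<length bs. Ks ! i * bs ! i) = 0" for Ks
      by (intro sum.neutral) auto
    moreover have "1 \<in> complex_field.Span \<rat> bs"
      using bs subringE(3)[OF subfieldE(1)[OF subfield_K]] by (simp add: rational_basis_def)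
    then obtain Ks where "length Ks = length bs" "1 = complex_field.combine Ks bs"
      using complex_field.Span_mem_iff_length_version[OF subfield_Rats, of bs 1] by auto
    ultimately show False
      by (simp add: complex_field_combine)
  qed
  hence cp_root: "poly (map_poly of_rat (char_poly A)) \<theta> = 0"
    using poly_char_poly_mult_matrix[OF A] by blast
  have deg: "degree (char_poly A) = length bs" and
    cp_monic: "lead_coeff (char_poly A) = 1"
    using degree_monic_char_poly[OF Ac] by simp_all
  have "char_poly A \<noteq> 0" using cp_monic by auto
  hence "degree F \<le> length bs"
    using irreducible_root_degree_le_rat[OF irr root _ cp_root] deg by simp
  with len show len_eq: "length bs = degree F" by (rule antisym)
  define D where "D = char_poly A - map_poly of_int F"
  have "map_poly of_rat (map_poly rat_of_int F) = (map_poly of_int F :: complex poly)"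
    by (simp add: map_poly_map_poly o_def)
  hence map_D: "map_poly of_rat D = map_poly of_rat (char_poly A) - (map_poly of_int F :: complex poly)"
    unfolding D_def by (intro poly_eqI) (auto simp: coeff_map_poly of_rat_diff)
  have D_root: "poly (map_poly of_rat D) \<theta> = 0"
    using root cp_root by (simp add: map_D)
  \<comment> \<open>The leading terms of the two monic polynomials cancel, and a nonzero polynomial
    of degree below \<open>degree F\<close> cannot vanish at \<open>\<theta>\<close>.\<close>
  have "D = 0"
  proof (rule ccontr)
    assume "D \<noteq> 0"
    hence "degree F \<le> degree D"
      by (rule irreducible_root_degree_le_rat[OF irr root _ D_root])
    moreover have "degree D \<le> degree F"
      unfolding D_def by (rule degree_diff_le) (simp_all add: deg len_eq)
    ultimately have "degree D = degree F" by (rule antisym[rotated])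
    hence "lead_coeff D = coeff (char_poly A) (degree F) - of_int (coeff F (degree F))"
      by (simp add: D_def)
    also have "\<dots> = 0" using cp_monic unfolding deg len_eq monic by simp
    finally show False using \<open>D \<noteq> 0\<close> by (simp only: leading_coeff_0_iff)
  qed
  thus "char_poly A = map_poly of_int F" by (simp add: D_def)
qed

text \<open>There is a basis of at most \<open>degree F\<close> elements, and
  \<open>rational_basis_char_poly\<close> excludes a shorter one.\<close>

lemma dimension_K: "complex_field.dimension (degree F) \<rat> K"
proof -
  have "F \<noteq> 0" using monic by auto
  then obtain d where d: "d \<le> degree F" "complex_field.dimension d \<rat> K"
    using generate_field_dimension_le[OF _ root] by (auto simp: K_def)
  then obtain bs where bs: "rational_basis K bs" "length bs = d"
    using complex_field.exists_base[OF subfield_Rats d(2)] by (auto simp: rational_basis_def)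
  obtain A where "is_mult_matrix bs \<theta> A"
    using ex_mult_matrix[OF subfield_K theta_in_K bs(1)] .
  hence "d = degree F" using rational_basis_char_poly(1)[OF bs(1)] bs(2) d(1) by simp
  thus ?thesis using d(2) by simp
qed

lemma number_field_K: "number_field K"
  using subfield_K complex_field.finite_dimensionI[OF dimension_K] by (simp add: number_field_def)

lemma field_degree_K: "field_degree K = degree F"
  using complex_field.dimI[OF subfield_Rats dimension_K] by (simp add: field_degree_def over_def)

lemma length_rational_basis: "rational_basis K bs \<Longrightarrow> length bs = degree F"
  using complex_field.dimension_independent[of \<rat> bs] dimension_K
    complex_field.dimension_is_inj[OF subfield_Rats] by (auto simp: rational_basis_def)

text \<open>Every basis and every matrix yield \<open>F\<close>, so the definite description is
  settled without a change-of-basis argument.\<close>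

lemma int_char_poly_eq: "int_char_poly K \<theta> = F"
  unfolding int_char_poly_def
proof (rule the_equality)
  obtain bs where bs: "rational_basis K bs"
    using complex_field.exists_base[OF subfield_Rats dimension_K] by (auto simp: rational_basis_def)
  moreover obtain A where "is_mult_matrix bs \<theta> A"
    using ex_mult_matrix[OF subfield_K theta_in_K bs] by blast
  ultimately show "\<exists>bs A. rational_basis K bs \<and> is_mult_matrix bs \<theta> A \<and>
      map_poly rat_of_int F = char_poly A"
    using rational_basis_char_poly(2) length_rational_basis by fastforce
next
  fix G assume "\<exists>bs A. rational_basis K bs \<and> is_mult_matrix bs \<theta> A \<and>
      map_poly rat_of_int G = char_poly A"
  hence "map_poly rat_of_int G = map_poly of_int F"
    using rational_basis_char_poly(2) length_rational_basis by fastforce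
  thus "G = F" by simp
qed

lemma theta_primitive: "\<theta> \<in> primitive_integers K"
  using theta_in_K monic root
  by (auto simp: primitive_integers_def ring_of_integers_def K_def algebraic_int_altdef_ipoly)

text \<open>An lcm is a multiple of each of its entries, so the single element
  \<open>\<theta>\<close> suffices.\<close>

lemma dvd_field_index:
  assumes "\<And>x. m dvd poly F x"
  shows "m dvd field_index K"
proof -
  have "m dvd element_index K \<theta>"
    unfolding element_index_def int_char_poly_eq using assms by (auto intro: Gcd_greatest)
  also have "element_index K \<theta> dvd field_index K"
    unfolding field_index_def using theta_primitive by (intro dvd_Lcm) auto
  finally show ?thesis .
qed

end

section \<open>Fermat's little theorem and the explicit polynomial\<close>

lemma prime_dvd_power_diff:
  fixes x :: int
  assumes "prime p"
  shows "int p dvd x ^ p - x"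
proof -
  \<comment> \<open>\<open>fermat_theorem\<close> concerns natural numbers, so \<open>x\<close> is
    replaced by its nonnegative residue.\<close>
  define y where "y = nat (x mod int p)"
  have p: "p > 0" using assms prime_gt_0_nat by blast
  have "[y ^ p = y] (mod p)"
  proof (cases "p dvd y")
    case True
    thus ?thesis using p by (metis cong_def dvd_power dvd_imp_mod_0 dvd_trans)
  next
    case False
    from cong_mult[OF cong_refl[of y] fermat_theorem[OF assms False]]
    show ?thesis using p by (simp flip: power_Suc)
  qed
  hence "[int y ^ p = int y] (mod int p)"
    by (metis cong_int_iff of_nat_power)
  moreover have "[x = int y] (mod int p)"
    using p by (simp add: y_def cong_def)
  ultimately have "[x ^ p = x] (mod int p)"
    by (meson cong_pow cong_sym cong_trans)
  thus ?thesis by (simp add: cong_iff_dvd_diff)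
qed

theorem theorem1p1:
  fixes n p :: nat
  assumes "n \<ge> 1" and "prime p" and "p \<le> n"
  shows "\<exists>K. number_field K \<and> field_degree K = n \<and> int p dvd field_index K"
proof -
  have p2: "p \<ge> 2" using assms(2) prime_ge_2_nat by blast
  \<comment> \<open>The middle coefficient must be \<open>-1\<close> modulo \<open>p\<close> and
    have a prime divisor; \<open>p - 1\<close> would fail for \<open>p = 2\<close>, whereas
    \<open>2 * p - 1\<close> is at least \<open>3\<close>.\<close>
  obtain q where q: "prime q" "q dvd 2 * p - 1"
    using prime_factor_nat[of "2 * p - 1"] p2 by fastforce
  have qp: "\<not> q dvd p"
  proof
    assume "q dvd p"
    hence "q dvd 2 * p - (2 * p - 1)" by (rule dvd_diff_nat[OF dvd_mult q(2)])
    also have "2 * p - (2 * p - 1) = 1" using p2 by simp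
    finally show False using q(1) by simp
  qed
  have "int q dvd int (2 * p - 1)" using q(2) by (simp only: int_dvd_int_iff)
  also have "int (2 * p - 1) = 2 * int p - 1" using p2 by simp
  finally have q_int: "int q dvd 2 * int p - 1" .
  \<comment> \<open>With this exponent, \<open>x ^ m\<close> is \<open>x ^ (n - p) * x\<close>. As
    \<open>2 \<le> p \<le> n\<close>, it lies strictly between \<open>0\<close> and
    \<open>n\<close>, so the three terms of \<open>F\<close> do not collide.\<close>
  define m where "m = n - p + 1"
  have m: "0 < m" "m < n" "n = (n - p) + p" using assms(3) p2 by (auto simp: m_def)
  \<comment> \<open>In the constant term, \<open>p\<close> keeps the values divisible by
    \<open>p\<close>, and \<open>q\<close> occurs exactly once, as Eisenstein's criterion
    demands.\<close>
  define G :: "int poly" where "G = monom (2 * int p - 1) m + [:int p * int q:]"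
  define F :: "int poly" where "F = monom 1 n + G"
  have coeff_F: "coeff F i = (if i = n then 1 else if i = m then 2 * int p - 1
      else if i = 0 then int p * int q else 0)" for i
    using m by (auto simp: F_def G_def coeff_pCons split: nat.splits)
  have deg: "degree F = n"
    by (rule antisym[OF degree_le le_degree]) (use m in \<open>auto simp: coeff_F\<close>)
  have monic: "lead_coeff F = 1" by (simp add: deg coeff_F)
  have prime_q: "prime_elem (int q)" using q(1) by simp
  have irr: "irreducible F"
  proof (rule eisenstein[OF prime_q monic])
    have "\<not> int q ^ 2 dvd int p * int q"
      using qp prime_gt_0_nat[OF q(1)] by (simp add: power2_eq_square int_dvd_int_iff)
    thus "\<not> int q ^ 2 dvd coeff F 0" using m by (simp add: coeff_F)
  qed (use m q_int in \<open>auto simp: deg coeff_F\<close>)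
  have "degree (map_poly complex_of_int F) = n" by (simp add: deg)
  hence "\<not> constant (poly (map_poly complex_of_int F))"
    using m by (simp add: constant_degree)
  then obtain \<theta> where \<theta>: "poly (map_poly complex_of_int F) \<theta> = 0"
    using fundamental_theorem_of_algebra by blast
  interpret irreducible_monic_root F \<theta>
    by unfold_locales (fact irr monic \<theta>)+
  have "int p dvd poly F x" for x
  proof -
    have "x ^ n = x ^ (n - p) * x ^ p" by (subst m(3), rule power_add)
    \<comment> \<open>Splitting \<open>2 * p - 1\<close> into \<open>2 * p\<close> and
      \<open>-1\<close> separates a multiple of \<open>p\<close> from the Fermat part.\<close>
    hence "poly F x = x ^ (n - p) * (x ^ p - x) + int p * (2 * x ^ m + int q)"
      by (simp add: F_def G_def poly_monom m_def algebra_simps)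
    thus ?thesis using prime_dvd_power_diff[OF assms(2), of x] by simp
  qed
  hence "int p dvd field_index K" by (rule dvd_field_index)
  with number_field_K field_degree_K deg show ?thesis by blast
qed

end
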